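(* Let $\mathcal{I}=\{I_m\}_{m\in\mathbb{N}}$ and $\mathcal{J}=\{J_m\}_{m\in\mathbb{N}}$ be discrete valued filtrations of a Noetherian ring $R$ and let $\alpha\in\mathbb{R}_{>0}$. Then $\overline{\nu}_{\mathcal{I}}=\alpha\,\overline{\nu}_{\mathcal{J}}$ if and only if $\mathcal{J}=\mathcal{I}^{[\alpha]}$.
   Context: Rings are commutative with identity, and $\mathbb{N}$ denotes the nonnegative integers. A filtration of a ring $R$ is a family $\mathcal{I} = \{I_m\}_{m\in\mathbb{N}}$ of ideals of $R$ with $I_0 = R$, $I_n \supseteq I_{n+1}$ and $I_n I_m \subseteq I_{n+m}$ for all $m,n \in \mathbb{N}$. The order of $\mathcal{I}$ is $\nu_{\mathcal{I}}(f) = \sup\{m \mid f \in I_m\} \in \mathbb{N}\cup\{\infty\}$ for $f \in R$. The asymptotic Samuel function of $\mathcal{I}$ is $\overline{\nu}_{\mathcal{I}} : R \to \mathbb{R}_{\ge 0}\cup\{\infty\}$, $\overline{\nu}_{\mathcal{I}}(x) = \lim_{n\to\infty} \nu_{\mathcal{I}}(x^n)/n$ (this limit always exists in $\mathbb{R}_{\ge 0}\cup\{\infty\}$); $\alpha\cdot\infty=\infty$ for $\alpha\in\mathbb{R}_{>0}$. A discrete valuation of $R$ is a map $v: R\to\mathbb{Z}\cup\{\infty\}$ obtained as follows: there are a minimal prime $P$ of $R$ and a rank 1 discrete valuation $v$ of the quotient field $\kappa(P)$ of $R/P$, with value group identified with $\mathbb{Z}$ (so $v$ is surjective from $\kappa(P)^{\times}$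 onto $\mathbb{Z}$), nonnegative on $R/P$; for $r\in R$ set $v(r)$ to be the value of the image of $r$ in $R/P$ if $r\notin P$, and $v(r)=\infty$ if $r\in P$. For $c\in\mathbb{R}_{\ge0}$, $I(v)_c = \{f\in R\mid v(f)\ge c\}$. A discrete valued filtration of $R$ is a filtration $\mathcal{I}=\{I_m\}_{m\in\mathbb{N}}$ for which there are $s\geq 1$, discrete valuations $v_1,\ldots,v_s$ of $R$ and $a_1,\ldots,a_s\in\mathbb{R}_{>0}$ with $I_m = \bigcap_{i=1}^s I(v_i)_{a_im}$ for all $m\in\mathbb{N}$. For such $\mathcal{I}$ and $\alpha\in\mathbb{R}_{>0}$, $\mathcal{I}^{[\alpha]} = \{I^{[\alpha]}_m\}_{m\in\mathbb{N}}$ is the discrete valued filtration $I^{[\alpha]}_m = \bigcap_{i=1}^s I(v_i)_{\alpha m a_i}$; it is independent of the chosen representation of $\mathcal{I}$. *)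

theory Defs
  imports
    "HOL-Algebra.QuotRing"
    "HOL-Algebra.Ideal_Product"
    "HOL-Algebra.Ring_Divisibility"
    "HOL-Library.Extended_Nat"
    "HOL-Library.Extended_Real"
begin

definition filtration :: "('a, 'b) ring_scheme \<Rightarrow> (nat \<Rightarrow> 'a set) \<Rightarrow> bool" where
  "filtration R I \<longleftrightarrow>
     (\<forall>m. ideal (I m) R) \<and>
     I 0 = carrier R \<and>
     (\<forall>n. I (Suc n) \<subseteq> I n) \<and>
     (\<forall>m n. ideal_prod R (I n) (I m) \<subseteq> I (n + m))"

definition filtration_order :: "(nat \<Rightarrow> 'a set) \<Rightarrow> 'a \<Rightarrow> enat" where
  "filtration_order I f = Sup {enat m | m. f \<in> I m}"

text \<open>The term at \<open>n = 0\<close> is a junk value, which does not affect the limit.\<close>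

definition asymptotic_samuel ::
    "('a, 'b) ring_scheme \<Rightarrow> (nat \<Rightarrow> 'a set) \<Rightarrow> 'a \<Rightarrow> ereal" where
  "asymptotic_samuel R I x =
     lim (\<lambda>n. ereal_of_enat (filtration_order I (x [^]\<^bsub>R\<^esub> n)) / ereal (real n))"

definition minimal_prime :: "('a, 'b) ring_scheme \<Rightarrow> 'a set \<Rightarrow> bool" where
  "minimal_prime R P \<longleftrightarrow>
     primeideal P R \<and> (\<forall>Q. primeideal Q R \<longrightarrow> Q \<subseteq> P \<longrightarrow> Q = P)"

text \<open>
  The quotient field of a domain \<open>D\<close>: its elements are the classes \<open>a / b\<close> of pairs
  under \<open>a / b = c / d \<longleftrightarrow> a d = c b\<close>, where \<open>b\<close> and \<open>d\<close> are nonzero.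
\<close>

definition fraction_rel :: "('a, 'b) ring_scheme \<Rightarrow> (('a \<times> 'a) \<times> ('a \<times> 'a)) set" where
  "fraction_rel D =
     {((a, b), (c, d)) | a b c d.
        a \<in> carrier D \<and> b \<in> carrier D - {\<zero>\<^bsub>D\<^esub>} \<and>
        c \<in> carrier D \<and> d \<in> carrier D - {\<zero>\<^bsub>D\<^esub>} \<and>
        a \<otimes>\<^bsub>D\<^esub> d = c \<otimes>\<^bsub>D\<^esub> b}"

definition fraction :: "('a, 'b) ring_scheme \<Rightarrow> 'a \<Rightarrow> 'a \<Rightarrow> ('a \<times> 'a) set" where
  "fraction D a b = fraction_rel D `` {(a, b)}"

definition fraction_field :: "('a, 'b) ring_scheme \<Rightarrow> ('a \<times> 'a) set ring" where
  "fraction_field D =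
     \<lparr>carrier = {fraction D a b | a b. a \<in> carrier D \<and> b \<in> carrier D - {\<zero>\<^bsub>D\<^esub>}},
      monoid.mult = (\<lambda>X Y. \<Union>(a, b)\<in>X. \<Union>(c, d)\<in>Y. fraction D (a \<otimes>\<^bsub>D\<^esub> c) (b \<otimes>\<^bsub>D\<^esub> d)),
      one = fraction D \<one>\<^bsub>D\<^esub> \<one>\<^bsub>D\<^esub>,
      zero = fraction D \<zero>\<^bsub>D\<^esub> \<one>\<^bsub>D\<^esub>,
      add = (\<lambda>X Y. \<Union>(a, b)\<in>X. \<Union>(c, d)\<in>Y.
               fraction D (a \<otimes>\<^bsub>D\<^esub> d \<oplus>\<^bsub>D\<^esub> c \<otimes>\<^bsub>D\<^esub> b) (b \<otimes>\<^bsub>D\<^esub> d))\<rparr>"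

text \<open>
  A rank 1 discrete valuation of the field \<open>K\<close>, with value group all of the integers.
  Only the values of \<open>w\<close> on nonzero elements matter; the convention that zero has
  value infinity is built into the lifting to the ring below.
\<close>

definition field_discrete_valuation :: "('k, 'b) ring_scheme \<Rightarrow> ('k \<Rightarrow> int) \<Rightarrow> bool" where
  "field_discrete_valuation K w \<longleftrightarrow>
     (\<forall>x \<in> carrier K - {\<zero>\<^bsub>K\<^esub>}. \<forall>y \<in> carrier K - {\<zero>\<^bsub>K\<^esub>}.
        w (x \<otimes>\<^bsub>K\<^esub> y) = w x + w y) \<and>
     (\<forall>x \<in> carrier K - {\<zero>\<^bsub>K\<^esub>}. \<forall>y \<in> carrier K - {\<zero>\<^bsub>K\<^esub>}.
        x \<oplus>\<^bsub>K\<^esub> y \<noteq> \<zero>\<^bsub>K\<^esub> \<longrightarrow> min (w x) (w y) \<le> w (x \<oplus>\<^bsub>K\<^esub> y)) \<and>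
     w ` (carrier K - {\<zero>\<^bsub>K\<^esub>}) = UNIV"

abbreviation residue_field :: "('a, 'b) ring_scheme \<Rightarrow> 'a set \<Rightarrow> ('a set \<times> 'a set) set ring" where
  "residue_field R P \<equiv> fraction_field (R Quot P)"

definition to_residue_field ::
    "('a, 'b) ring_scheme \<Rightarrow> 'a set \<Rightarrow> 'a \<Rightarrow> ('a set \<times> 'a set) set" where
  "to_residue_field R P r = fraction (R Quot P) (P +>\<^bsub>R\<^esub> r) \<one>\<^bsub>R Quot P\<^esub>"

text \<open>
  Values in \<open>\<int> \<union> {\<infinity>}\<close> are represented as extended reals; the values outside the
  carrier of \<open>R\<close> are irrelevant.
\<close>

definition discrete_valuation :: "('a, 'b) ring_scheme \<Rightarrow> ('a \<Rightarrow> ereal) \<Rightarrow> bool" where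
  "discrete_valuation R v \<longleftrightarrow>
     (\<exists>P w. minimal_prime R P \<and>
        field_discrete_valuation (residue_field R P) w \<and>
        (\<forall>r \<in> carrier R - P. 0 \<le> w (to_residue_field R P r)) \<and>
        (\<forall>r \<in> carrier R. v r =
           (if r \<in> P then \<infinity> else ereal (of_int (w (to_residue_field R P r))))))"

definition valuation_ideal ::
    "('a, 'b) ring_scheme \<Rightarrow> ('a \<Rightarrow> ereal) \<Rightarrow> real \<Rightarrow> 'a set" where
  "valuation_ideal R v c = {f \<in> carrier R. ereal c \<le> v f}"

definition valued_family ::
    "('a, 'b) ring_scheme \<Rightarrow> nat \<Rightarrow> (nat \<Rightarrow> 'a \<Rightarrow> ereal) \<Rightarrow> (nat \<Rightarrow> real) \<Rightarrow> nat \<Rightarrow> 'a set" where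
  "valued_family R s v a m = (\<Inter>i\<in>{1..s}. valuation_ideal R (v i) (a i * real m))"

definition dv_representation ::
    "('a, 'b) ring_scheme \<Rightarrow> nat \<Rightarrow> (nat \<Rightarrow> 'a \<Rightarrow> ereal) \<Rightarrow> (nat \<Rightarrow> real) \<Rightarrow>
     (nat \<Rightarrow> 'a set) \<Rightarrow> bool" where
  "dv_representation R s v a I \<longleftrightarrow>
     1 \<le> s \<and>
     (\<forall>i\<in>{1..s}. discrete_valuation R (v i)) \<and>
     (\<forall>i\<in>{1..s}. 0 < a i) \<and>
     I = valued_family R s v a"

definition discrete_valued_filtration ::
    "('a, 'b) ring_scheme \<Rightarrow> (nat \<Rightarrow> 'a set) \<Rightarrow> bool" where
  "discrete_valued_filtration R I \<longleftrightarrow>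
     filtration R I \<and> (\<exists>s v a. dv_representation R s v a I)"

text \<open>
  The filtration \<open>I\<^sup>[\<^sup>\<alpha>\<^sup>]\<close>, formed from some representation of \<open>I\<close>; the lemma
  \<open>scaled_filtration_eq\<close> below shows that any representation gives the same result.
\<close>

definition scaled_filtration ::
    "('a, 'b) ring_scheme \<Rightarrow> (nat \<Rightarrow> 'a set) \<Rightarrow> real \<Rightarrow> nat \<Rightarrow> 'a set" where
  "scaled_filtration R I \<alpha> =
     (SOME K. \<exists>s v a. dv_representation R s v a I \<and>
                      K = valued_family R s v (\<lambda>i. \<alpha> * a i))"


context domain
begin

lemma fraction_rel_iff:
  "((a, b), (c, d)) \<in> fraction_rel R \<longleftrightarrow>
     a \<in> carrier R \<and> b \<in> carrier R - {\<zero>} \<and> c \<in> carrier R \<and> d \<in> carrier R - {\<zero>} \<and>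
     a \<otimes> d = c \<otimes> b"
  by (auto simp: fraction_rel_def)

lemma equiv_fraction_rel: "equiv (carrier R \<times> (carrier R - {\<zero>})) (fraction_rel R)"
proof (rule equivI)
  show "fraction_rel R \<subseteq> (carrier R \<times> (carrier R - {\<zero>})) \<times> (carrier R \<times> (carrier R - {\<zero>}))"
    by (auto simp: fraction_rel_def)
  show "refl_on (carrier R \<times> (carrier R - {\<zero>})) (fraction_rel R)"
    by (auto simp: refl_on_def fraction_rel_iff)
  show "sym (fraction_rel R)"
    by (auto simp: sym_def fraction_rel_iff)
  show "trans (fraction_rel R)"
  proof (rule transI, clarify)
    fix a b c d e f
    assume "((a, b), (c, d)) \<in> fraction_rel R" "((c, d), (e, f)) \<in> fraction_rel R"
    then have cl: "a \<in> carrier R" "b \<in> carrier R" "c \<in> carrier R" "d \<in> carrier R"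
        "e \<in> carrier R" "f \<in> carrier R" and nz: "b \<noteq> \<zero>" "d \<noteq> \<zero>" "f \<noteq> \<zero>"
      and eq: "a \<otimes> d = c \<otimes> b" "c \<otimes> f = e \<otimes> d"
      by (auto simp: fraction_rel_iff)
    have "d \<otimes> (a \<otimes> f) = (a \<otimes> d) \<otimes> f" using cl by (simp add: m_ac)
    also have "\<dots> = (c \<otimes> f) \<otimes> b" using cl eq by (simp add: m_ac)
    also have "\<dots> = d \<otimes> (e \<otimes> b)" using cl eq by (simp add: m_ac)
    finally have "a \<otimes> f = e \<otimes> b" using m_lcancel[OF nz(2)] cl by simp
    then show "((a, b), (e, f)) \<in> fraction_rel R" using cl nz by (simp add: fraction_rel_iff)
  qed
qed

lemma fraction_eq_iff:
  assumes "a \<in> carrier R" "b \<in> carrier R - {\<zero>}" "c \<in> carrier R" "d \<in> carrier R - {\<zero>}"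
  shows "fraction R a b = fraction R c d \<longleftrightarrow> a \<otimes> d = c \<otimes> b"
  using eq_equiv_class_iff[OF equiv_fraction_rel, of "(a, b)" "(c, d)"] assms
  by (simp add: fraction_def fraction_rel_iff)

lemma mem_fraction:
  "(c, d) \<in> fraction R a b \<longleftrightarrow> ((a, b), (c, d)) \<in> fraction_rel R"
  by (simp add: fraction_def)

lemma nonzero_mult_closed:
  assumes "b \<in> carrier R - {\<zero>}" "d \<in> carrier R - {\<zero>}"
  shows "b \<otimes> d \<in> carrier R - {\<zero>}"
  using assms integral by auto

lemma fraction_field_mult:
  assumes "a \<in> carrier R" "b \<in> carrier R - {\<zero>}" "c \<in> carrier R" "d \<in> carrier R - {\<zero>}"
  shows "fraction R a b \<otimes>\<^bsub>fraction_field R\<^esub> fraction R c d = fraction R (a \<otimes> c) (b \<otimes> d)"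
proof -
  have 1: "fraction R (a' \<otimes> c') (b' \<otimes> d') = fraction R (a \<otimes> c) (b \<otimes> d)"
    if "(a', b') \<in> fraction R a b" "(c', d') \<in> fraction R c d" for a' b' c' d'
  proof -
    have cl: "a' \<in> carrier R" "b' \<in> carrier R - {\<zero>}" "c' \<in> carrier R" "d' \<in> carrier R - {\<zero>}"
      and eq: "a \<otimes> b' = a' \<otimes> b" "c \<otimes> d' = c' \<otimes> d"
      using that by (auto simp: mem_fraction fraction_rel_iff)
    have "(a' \<otimes> c') \<otimes> (b \<otimes> d) = (a' \<otimes> b) \<otimes> (c' \<otimes> d)" using cl assms by (simp add: m_ac)
    also have "\<dots> = (a \<otimes> b') \<otimes> (c \<otimes> d')" using eq by simp
    also have "\<dots> = (a \<otimes> c) \<otimes> (b' \<otimes> d')" using cl assms by (simp add: m_ac)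
    finally show ?thesis
      using cl assms nonzero_mult_closed[of b d] nonzero_mult_closed[of b' d']
      by (subst fraction_eq_iff) auto
  qed
  have 2: "(a, b) \<in> fraction R a b" "(c, d) \<in> fraction R c d"
    using assms by (auto simp: mem_fraction fraction_rel_iff)
  have "(\<Union>(a', b')\<in>fraction R a b. \<Union>(c', d')\<in>fraction R c d. fraction R (a' \<otimes> c') (b' \<otimes> d'))
        = fraction R (a \<otimes> c) (b \<otimes> d)"
    using 1 2 by fast
  then show ?thesis by (simp add: fraction_field_def)
qed

lemma fraction_field_add:
  assumes "a \<in> carrier R" "b \<in> carrier R - {\<zero>}" "c \<in> carrier R" "d \<in> carrier R - {\<zero>}"
  shows "fraction R a b \<oplus>\<^bsub>fraction_field R\<^esub> fraction R c d
           = fraction R (a \<otimes> d \<oplus> c \<otimes> b) (b \<otimes> d)"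
proof -
  have 1: "fraction R (a' \<otimes> d' \<oplus> c' \<otimes> b') (b' \<otimes> d') = fraction R (a \<otimes> d \<oplus> c \<otimes> b) (b \<otimes> d)"
    if "(a', b') \<in> fraction R a b" "(c', d') \<in> fraction R c d" for a' b' c' d'
  proof -
    have cl: "a' \<in> carrier R" "b' \<in> carrier R - {\<zero>}" "c' \<in> carrier R" "d' \<in> carrier R - {\<zero>}"
      and eq: "a \<otimes> b' = a' \<otimes> b" "c \<otimes> d' = c' \<otimes> d"
      using that by (auto simp: mem_fraction fraction_rel_iff)
    have "(a' \<otimes> d' \<oplus> c' \<otimes> b') \<otimes> (b \<otimes> d) = (a' \<otimes> b) \<otimes> (d \<otimes> d') \<oplus> (c' \<otimes> d) \<otimes> (b \<otimes> b')"
      using cl assms by (simp add: l_distr r_distr m_ac)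
    also have "\<dots> = (a \<otimes> b') \<otimes> (d \<otimes> d') \<oplus> (c \<otimes> d') \<otimes> (b \<otimes> b')" using eq by simp
    also have "\<dots> = (a \<otimes> d \<oplus> c \<otimes> b) \<otimes> (b' \<otimes> d')" using cl assms by (simp add: l_distr r_distr m_ac)
    finally show ?thesis
      using cl assms nonzero_mult_closed[of b d] nonzero_mult_closed[of b' d']
      by (subst fraction_eq_iff) auto
  qed
  have 2: "(a, b) \<in> fraction R a b" "(c, d) \<in> fraction R c d"
    using assms by (auto simp: mem_fraction fraction_rel_iff)
  have "(\<Union>(a', b')\<in>fraction R a b. \<Union>(c', d')\<in>fraction R c d.
           fraction R (a' \<otimes> d' \<oplus> c' \<otimes> b') (b' \<otimes> d'))
        = fraction R (a \<otimes> d \<oplus> c \<otimes> b) (b \<otimes> d)"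
    using 1 2 by fast
  then show ?thesis by (simp add: fraction_field_def)
qed

lemma fraction_field_carrier:
  "carrier (fraction_field R) =
     {fraction R a b | a b. a \<in> carrier R \<and> b \<in> carrier R - {\<zero>}}"
  and fraction_field_one: "\<one>\<^bsub>fraction_field R\<^esub> = fraction R \<one> \<one>"
  and fraction_field_zero: "\<zero>\<^bsub>fraction_field R\<^esub> = fraction R \<zero> \<one>"
  by (auto simp: fraction_field_def)

lemma fraction_eq_zero_iff:
  assumes "a \<in> carrier R" "b \<in> carrier R - {\<zero>}"
  shows "fraction R a b = \<zero>\<^bsub>fraction_field R\<^esub> \<longleftrightarrow> a = \<zero>"
  using assms by (simp add: fraction_field_zero fraction_eq_iff)

lemma fraction_in_carrier:
  assumes "a \<in> carrier R" "b \<in> carrier R - {\<zero>}"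
  shows "fraction R a b \<in> carrier (fraction_field R)"
  using assms by (auto simp: fraction_field_carrier)

lemma fraction_field_cases:
  assumes "x \<in> carrier (fraction_field R)"
  obtains a b where "a \<in> carrier R" "b \<in> carrier R" "b \<noteq> \<zero>" "x = fraction R a b"
  using assms by (auto simp: fraction_field_carrier)

lemma field_fraction_field: "field (fraction_field R)"
proof -
  note simps = fraction_field_mult fraction_field_add fraction_field_one fraction_field_zero
    fraction_eq_iff fraction_in_carrier integral_iff
  have "cring (fraction_field R)"
  proof (rule cringI)
    show "abelian_group (fraction_field R)"
    proof (rule abelian_groupI)
      fix x assume "x \<in> carrier (fraction_field R)"
      then show "\<exists>y\<in>carrier (fraction_field R). y \<oplus>\<^bsub>fraction_field R\<^esub> x = \<zero>\<^bsub>fraction_field R\<^esub>"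
      proof (cases rule: fraction_field_cases)
        case (1 a b)
        then show ?thesis
          by (intro bexI[of _ "fraction R (\<ominus> a) b"]) (auto simp: simps l_minus l_neg)
      qed
    qed (auto elim!: fraction_field_cases simp: simps l_distr r_distr m_ac a_ac)
    show "Group.comm_monoid (fraction_field R)"
      by (rule comm_monoidI) (auto elim!: fraction_field_cases simp: simps m_ac)
  next
    fix x y z
    assume "x \<in> carrier (fraction_field R)" "y \<in> carrier (fraction_field R)"
      "z \<in> carrier (fraction_field R)"
    then show "(x \<oplus>\<^bsub>fraction_field R\<^esub> y) \<otimes>\<^bsub>fraction_field R\<^esub> z =
        x \<otimes>\<^bsub>fraction_field R\<^esub> z \<oplus>\<^bsub>fraction_field R\<^esub> y \<otimes>\<^bsub>fraction_field R\<^esub> z"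
    proof (elim fraction_field_cases)
      fix a b c d e f
      assume cl: "a \<in> carrier R" "b \<in> carrier R" "c \<in> carrier R" "d \<in> carrier R"
          "e \<in> carrier R" "f \<in> carrier R" and nz: "b \<noteq> \<zero>" "d \<noteq> \<zero>" "f \<noteq> \<zero>"
        and xyz: "x = fraction R a b" "y = fraction R c d" "z = fraction R e f"
      have "((a \<otimes> d \<oplus> c \<otimes> b) \<otimes> e) \<otimes> ((b \<otimes> f) \<otimes> (d \<otimes> f))
          = ((a \<otimes> e) \<otimes> (d \<otimes> f) \<oplus> (c \<otimes> e) \<otimes> (b \<otimes> f)) \<otimes> ((b \<otimes> d) \<otimes> f)"
        using cl by (simp add: l_distr r_distr m_ac)
      then show ?thesis
        using cl nz unfolding xyz
        by (simp add: fraction_field_mult fraction_field_add fraction_eq_iff integral_iff)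
    qed
  qed
  then interpret F: cring "fraction_field R" .
  show ?thesis
  proof (rule F.cring_fieldI2)
    show "\<zero>\<^bsub>fraction_field R\<^esub> \<noteq> \<one>\<^bsub>fraction_field R\<^esub>" by (simp add: simps)
    fix x assume x: "x \<in> carrier (fraction_field R)" "x \<noteq> \<zero>\<^bsub>fraction_field R\<^esub>"
    from x(1) show "\<exists>y\<in>carrier (fraction_field R). x \<otimes>\<^bsub>fraction_field R\<^esub> y = \<one>\<^bsub>fraction_field R\<^esub>"
    proof (cases rule: fraction_field_cases)
      case (1 a b)
      with x(2) have "a \<noteq> \<zero>" by (simp add: simps)
      with 1 show ?thesis
        by (intro bexI[of _ "fraction R b a"]) (auto simp: simps m_ac)
    qed
  qed
qed

end

lemma to_residue_field_mult:
  assumes "primeideal P R" "x \<in> carrier R" "y \<in> carrier R"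
  shows "to_residue_field R P (x \<otimes>\<^bsub>R\<^esub> y) =
           to_residue_field R P x \<otimes>\<^bsub>residue_field R P\<^esub> to_residue_field R P y"
proof -
  interpret P: primeideal P R by fact
  interpret D: domain "R Quot P" by (rule P.quotient_is_domain)
  have hom: "(+>\<^bsub>R\<^esub>) P \<in> ring_hom R (R Quot P)" by (rule P.rcos_ring_hom)
  show ?thesis
    unfolding to_residue_field_def using assms(2,3) ring_hom_closed[OF hom]
    by (subst D.fraction_field_mult) (auto simp: ring_hom_mult[OF hom])
qed

lemma to_residue_field_nonzero:
  assumes "primeideal P R" "x \<in> carrier R" "x \<notin> P"
  shows "to_residue_field R P x \<in> carrier (residue_field R P) - {\<zero>\<^bsub>residue_field R P\<^esub>}"
proof -
  interpret P: primeideal P R by fact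
  interpret D: domain "R Quot P" by (rule P.quotient_is_domain)
  have hom: "(+>\<^bsub>R\<^esub>) P \<in> ring_hom R (R Quot P)" by (rule P.rcos_ring_hom)
  have "P +>\<^bsub>R\<^esub> x \<noteq> \<zero>\<^bsub>R Quot P\<^esub>"
    using P.a_rcos_self[OF assms(2)] assms(3) by (auto simp: FactRing_def)
  then show ?thesis
    unfolding to_residue_field_def
    using ring_hom_closed[OF hom assms(2)] D.fraction_in_carrier D.fraction_eq_zero_iff by auto
qed

lemma discrete_valuation_power:
  assumes "discrete_valuation R v" "x \<in> carrier R"
  shows "v (x [^]\<^bsub>R\<^esub> Suc n) = ereal (real (Suc n)) * v x"
proof -
  from assms(1) obtain P w where mp: "minimal_prime R P"
    and w: "field_discrete_valuation (residue_field R P) w"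
    and veq: "\<forall>r \<in> carrier R. v r =
           (if r \<in> P then \<infinity> else ereal (of_int (w (to_residue_field R P r))))"
    unfolding discrete_valuation_def by (elim exE conjE)
  note v = bspec[OF veq]
  from mp have P: "primeideal P R" unfolding minimal_prime_def by (rule conjunct1)
  interpret P: primeideal P R by fact
  have mult: "v (y \<otimes>\<^bsub>R\<^esub> x) = v y + v x" if y: "y \<in> carrier R" for y
  proof (cases "y \<in> P \<or> x \<in> P")
    case True
    then have "y \<otimes>\<^bsub>R\<^esub> x \<in> P" using P.I_l_closed P.I_r_closed y assms(2) by blast
    then show ?thesis using True v[of y] v[of x] v[of "y \<otimes>\<^bsub>R\<^esub> x"] y assms(2) by auto
  next
    case False
    then have "y \<otimes>\<^bsub>R\<^esub> x \<notin> P" using P.I_prime y assms(2) by blast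
    moreover have "w (to_residue_field R P (y \<otimes>\<^bsub>R\<^esub> x))
        = w (to_residue_field R P y) + w (to_residue_field R P x)"
      unfolding to_residue_field_mult[OF P y assms(2)]
      using w[unfolded field_discrete_valuation_def, THEN conjunct1] False
        to_residue_field_nonzero[OF P y] to_residue_field_nonzero[OF P assms(2)] by blast
    ultimately show ?thesis
      using False v[of y] v[of x] v[of "y \<otimes>\<^bsub>R\<^esub> x"] y assms(2) by auto
  qed
  show ?thesis
  proof (induction n)
    case 0
    then show ?case using assms(2) by (simp add: one_ereal_def[symmetric])
  next
    case (Suc n)
    have "v (x [^]\<^bsub>R\<^esub> Suc (Suc n)) = v (x [^]\<^bsub>R\<^esub> Suc n) + v x"
      using mult[of "x [^]\<^bsub>R\<^esub> Suc n"] assms(2) by simp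
    also have "\<dots> = ereal (real (Suc n)) * v x + ereal 1 * v x"
      using Suc by (simp add: one_ereal_def[symmetric])
    also have "\<dots> = ereal (real (Suc (Suc n))) * v x"
      using v[OF assms(2)] by (auto simp: algebra_simps)
    finally show ?case .
  qed
qed

lemma valued_family_scale_iff:
  assumes "cring R" "dv_representation R s v a I" "0 < \<alpha>" "f \<in> carrier R"
  shows "f \<in> valued_family R s v (\<lambda>i. \<alpha> * a i) m \<longleftrightarrow>
           (\<forall>n. f [^]\<^bsub>R\<^esub> Suc n \<in> I (nat \<lfloor>real (Suc n) * \<alpha> * real m\<rfloor>))"
proof -
  interpret cring R by fact
  have rep: "1 \<le> s" "\<And>i. i \<in> {1..s} \<Longrightarrow> discrete_valuation R (v i)"
    "\<And>i. i \<in> {1..s} \<Longrightarrow> 0 < a i" and I: "I = valued_family R s v a"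
    using assms(2) by (auto simp: dv_representation_def)
  have key: "ereal (\<alpha> * a i * real m) \<le> v i f \<longleftrightarrow>
      (\<forall>n. ereal (a i * real (nat \<lfloor>real (Suc n) * \<alpha> * real m\<rfloor>)) \<le> v i (f [^]\<^bsub>R\<^esub> Suc n))"
    if i: "i \<in> {1..s}" for i
  proof -
    have pw: "v i (f [^]\<^bsub>R\<^esub> Suc n) = ereal (real (Suc n)) * v i f" for n
      using discrete_valuation_power[OF rep(2)[OF i] assms(4)] .
    have ai: "0 < a i" using rep(3)[OF i] .
    have "v i f \<noteq> - \<infinity>"
      using rep(2)[OF i] assms(4) unfolding discrete_valuation_def by auto
    then consider "v i f = \<infinity>" | r where "v i f = ereal r" by (cases "v i f") auto
    then show ?thesis
    proof cases
      case 1
      then show ?thesis unfolding pw by simp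
    next
      case (2 r)
      have "\<alpha> * a i * real m \<le> r \<longleftrightarrow>
        (\<forall>n. a i * real (nat \<lfloor>real (Suc n) * \<alpha> * real m\<rfloor>) \<le> real (Suc n) * r)" (is "?L \<longleftrightarrow> ?R")
      proof
        assume L: ?L
        show ?R
        proof
          fix n
          have "0 \<le> real (Suc n) * \<alpha> * real m" using assms(3) by simp
          then have "real (nat \<lfloor>real (Suc n) * \<alpha> * real m\<rfloor>) \<le> real (Suc n) * \<alpha> * real m"
            by linarith
          then have "a i * real (nat \<lfloor>real (Suc n) * \<alpha> * real m\<rfloor>) \<le> a i * (real (Suc n) * \<alpha> * real m)"
            using ai by (intro mult_left_mono) auto
          also have "\<dots> = real (Suc n) * (\<alpha> * a i * real m)" by simp
          also have "\<dots> \<le> real (Suc n) * r" using L by (intro mult_left_mono) auto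
          finally show "a i * real (nat \<lfloor>real (Suc n) * \<alpha> * real m\<rfloor>) \<le> real (Suc n) * r" .
        qed
      next
        assume R: ?R
        show ?L
        proof (rule ccontr)
          assume "\<not> ?L"
          then have "0 < \<alpha> * a i * real m - r" by simp
          from reals_Archimedean3[OF this]
          obtain N where "a i < real N * (\<alpha> * a i * real m - r)" by blast
          also have "\<dots> \<le> real (Suc N) * (\<alpha> * a i * real m - r)"
            using \<open>0 < \<alpha> * a i * real m - r\<close> by (intro mult_right_mono) auto
          finally have *: "a i < real (Suc N) * (\<alpha> * a i * real m - r)" .
          have "real (Suc N) * \<alpha> * real m - 1 \<le> real (nat \<lfloor>real (Suc N) * \<alpha> * real m\<rfloor>)"
            by linarith
          then have "a i * (real (Suc N) * \<alpha> * real m - 1)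
              \<le> a i * real (nat \<lfloor>real (Suc N) * \<alpha> * real m\<rfloor>)"
            using ai by (intro mult_left_mono) auto
          also have "\<dots> \<le> real (Suc N) * r" using R by blast
          finally have "a i * (real (Suc N) * \<alpha> * real m) - a i \<le> real (Suc N) * r"
            by (simp add: right_diff_distrib)
          moreover have "real (Suc N) * (\<alpha> * a i * real m - r)
              = a i * (real (Suc N) * \<alpha> * real m) - real (Suc N) * r"
            by (simp only: right_diff_distrib mult_ac)
          ultimately show False using * by linarith
        qed
      qed
      then show ?thesis unfolding pw 2 by simp
    qed
  qed
  have "f \<in> valued_family R s v (\<lambda>i. \<alpha> * a i) m \<longleftrightarrow>
      (\<forall>i\<in>{1..s}. ereal (\<alpha> * a i * real m) \<le> v i f)"
    using assms(4) by (auto simp: valued_family_def valuation_ideal_def)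
  also have "\<dots> \<longleftrightarrow> (\<forall>n. \<forall>i\<in>{1..s}.
      ereal (a i * real (nat \<lfloor>real (Suc n) * \<alpha> * real m\<rfloor>)) \<le> v i (f [^]\<^bsub>R\<^esub> Suc n))"
    using key by blast
  also have "\<dots> \<longleftrightarrow> (\<forall>n. f [^]\<^bsub>R\<^esub> Suc n \<in> I (nat \<lfloor>real (Suc n) * \<alpha> * real m\<rfloor>))"
    using assms(4) by (auto simp: I valued_family_def valuation_ideal_def)
  finally show ?thesis .
qed

lemma scaled_filtration_eq:
  assumes "cring R" "dv_representation R s v a I" "0 < \<alpha>"
  shows "scaled_filtration R I \<alpha> = valued_family R s v (\<lambda>i. \<alpha> * a i)"
proof -
  have sub: "valued_family R s v b m \<subseteq> carrier R" if "1 \<le> s" for s v b m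
    using that by (force simp: valued_family_def valuation_ideal_def)
  have uniq: "valued_family R s' v' (\<lambda>i. \<alpha> * a' i) = valued_family R s v (\<lambda>i. \<alpha> * a i)"
    if rep': "dv_representation R s' v' a' I" for s' v' a'
  proof (rule HOL.ext, rule Set.set_eqI)
    fix m f
    have "1 \<le> s" "1 \<le> s'" using assms(2) rep' by (auto simp: dv_representation_def)
    then show "f \<in> valued_family R s' v' (\<lambda>i. \<alpha> * a' i) m \<longleftrightarrow>
        f \<in> valued_family R s v (\<lambda>i. \<alpha> * a i) m"
      using valued_family_scale_iff[OF assms(1) rep' assms(3), of f m]
        valued_family_scale_iff[OF assms, of f m] sub[of s] sub[of s'] by blast
  qed
  have "\<exists>s' v' a'. dv_representation R s' v' a' I \<and>
      scaled_filtration R I \<alpha> = valued_family R s' v' (\<lambda>i. \<alpha> * a' i)"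
    unfolding scaled_filtration_def
    by (rule someI_ex[where P = "\<lambda>K. \<exists>s' v' a'. dv_representation R s' v' a' I \<and>
          K = valued_family R s' v' (\<lambda>i. \<alpha> * a' i)"]) (use assms(2) in blast)
  then show ?thesis using uniq by metis
qed

end

theory Submission
  imports Defs
begin

text \<open>
  If \<open>I\<close> is represented by \<open>v\<^sub>i\<close> and \<open>a\<^sub>i\<close>, then the asymptotic Samuel function of \<open>I\<close> is
  the minimum of the functions \<open>v\<^sub>i / a\<^sub>i\<close>, because the order of \<open>x\<^sup>n\<close> is the floor of \<open>n\<close>
  times that minimum. Hence \<open>I\<^sub>m\<close> is the set where this function is at least \<open>m\<close>, and
  replacing \<open>a\<^sub>i\<close> by \<open>\<alpha> a\<^sub>i\<close> divides it by \<open>\<alpha>\<close>.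
\<close>

lemma discrete_valuation_nonneg:
  assumes "discrete_valuation R v" "x \<in> carrier R"
  shows "0 \<le> v x"
  using assms unfolding discrete_valuation_def by force

text \<open>Positive finite factors can be cleared in \<open>ereal\<close>, so the minimum is
  determined by its lower bounds \<open>y\<close>, infinite ones included. Later comparisons of
  minima go through this form.\<close>

lemma le_INF_divide_iff:
  fixes v :: "nat \<Rightarrow> ereal" and a :: "nat \<Rightarrow> real"
  assumes "\<And>i. i \<in> A \<Longrightarrow> 0 < a i"
  shows "y \<le> (INF i\<in>A. v i / ereal (a i)) \<longleftrightarrow> (\<forall>i\<in>A. ereal (a i) * y \<le> v i)"
  using assms by (auto simp: le_INF_iff ereal_le_divide_pos)

text \<open>The floor itself satisfies the bound, so the supremum is attained there. This evaluates
  the order of a power when the minimum is finite.\<close>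

lemma enat_Sup_real_le:
  assumes "0 \<le> r"
  shows "Sup {enat m | m. real m \<le> r} = enat (nat \<lfloor>r\<rfloor>)"
proof (rule antisym)
  show "Sup {enat m | m. real m \<le> r} \<le> enat (nat \<lfloor>r\<rfloor>)"
    by (rule Sup_least) (auto simp: le_nat_floor)
  show "enat (nat \<lfloor>r\<rfloor>) \<le> Sup {enat m | m. real m \<le> r}"
    using assms by (intro Sup_upper) auto
qed

lemma Sup_range_enat: "Sup (range enat) = \<infinity>"
proof -
  have "infinite (range enat)"
    by (rule range_inj_infinite) (simp add: inj_on_def)
  then show ?thesis by (simp add: Sup_enat_def)
qed

text \<open>Rounding down loses less than 1, so the quotient lies between
  \<open>r - 1 / Suc n\<close> and \<open>r\<close>.\<close>

lemma floor_mult_over_tendsto: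
  fixes r :: real
  assumes "0 \<le> r"
  shows "(\<lambda>n. real (nat \<lfloor>real (Suc n) * r\<rfloor>) / real (Suc n)) \<longlonglongrightarrow> r"
proof (rule tendsto_sandwich)
  have eq: "real (nat \<lfloor>real (Suc n) * r\<rfloor>) = of_int \<lfloor>real (Suc n) * r\<rfloor>" for n
    using assms by simp
  show "\<forall>\<^sub>F n in sequentially. r - inverse (real (Suc n))
      \<le> real (nat \<lfloor>real (Suc n) * r\<rfloor>) / real (Suc n)"
  proof (rule always_eventually, rule allI)
    fix n
    have "r - inverse (real (Suc n)) = (real (Suc n) * r - 1) / real (Suc n)"
      by (simp add: field_simps)
    also have "\<dots> \<le> real (nat \<lfloor>real (Suc n) * r\<rfloor>) / real (Suc n)"
      unfolding eq by (intro divide_right_mono) linarith+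
    finally show "r - inverse (real (Suc n)) \<le> real (nat \<lfloor>real (Suc n) * r\<rfloor>) / real (Suc n)" .
  qed
  show "\<forall>\<^sub>F n in sequentially. real (nat \<lfloor>real (Suc n) * r\<rfloor>) / real (Suc n) \<le> r"
  proof (rule always_eventually, rule allI)
    fix n
    have "real (nat \<lfloor>real (Suc n) * r\<rfloor>) \<le> real (Suc n) * r"
      unfolding eq by (rule of_int_floor_le)
    then show "real (nat \<lfloor>real (Suc n) * r\<rfloor>) / real (Suc n) \<le> r"
      by (simp add: divide_le_eq mult.commute)
  qed
  show "(\<lambda>n. r - inverse (real (Suc n))) \<longlonglongrightarrow> r"
    using tendsto_diff[OF tendsto_const LIMSEQ_inverse_real_of_nat, of r] by simp
qed simp

text \<open>The valuation of the power is \<open>Suc n\<close> times that of \<open>x\<close>, so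
  each condition defining \<open>I m\<close> can be divided by \<open>Suc n\<close>. A positive
  exponent keeps this divisor nonzero.\<close>

lemma valued_family_power_iff:
  assumes "cring R" "dv_representation R s v a I" "x \<in> carrier R"
  shows "x [^]\<^bsub>R\<^esub> Suc n \<in> I m \<longleftrightarrow>
           ereal (real m / real (Suc n)) \<le> (INF i\<in>{1..s}. v i x / ereal (a i))"
proof -
  interpret cring R by fact
  have rep: "1 \<le> s" "\<And>i. i \<in> {1..s} \<Longrightarrow> discrete_valuation R (v i)"
    "\<And>i. i \<in> {1..s} \<Longrightarrow> 0 < a i" and I: "I = valued_family R s v a"
    using assms(2) by (auto simp: dv_representation_def)
  have "ereal (a i * real m) \<le> v i (x [^]\<^bsub>R\<^esub> Suc n) \<longleftrightarrow>
      ereal (a i) * ereal (real m / real (Suc n)) \<le> v i x" if i: "i \<in> {1..s}" for i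
    unfolding discrete_valuation_power[OF rep(2)[OF i] assms(3)]
    by (cases "v i x") (auto simp: field_simps simp del: of_nat_Suc)
  then have "x [^]\<^bsub>R\<^esub> Suc n \<in> I m \<longleftrightarrow>
      (\<forall>i\<in>{1..s}. ereal (a i) * ereal (real m / real (Suc n)) \<le> v i x)"
    using assms(3) rep(1) unfolding I valued_family_def valuation_ideal_def by auto
  then show ?thesis using le_INF_divide_iff[of "{1..s}" a] rep(3) by simp
qed

lemma asymptotic_samuel_eq_INF:
  assumes "cring R" "dv_representation R s v a I" "x \<in> carrier R"
  shows "asymptotic_samuel R I x = (INF i\<in>{1..s}. v i x / ereal (a i))" (is "_ = ?\<mu>")
proof -
  have pos: "0 < a i" and val: "discrete_valuation R (v i)" if "i \<in> {1..s}" for i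
    using assms(2) that by (auto simp: dv_representation_def)
  \<comment> \<open>Nonnegativity excludes minus infinity and makes the floors below legitimate
    natural numbers.\<close>
  have "0 \<le> ?\<mu>"
    using le_INF_divide_iff[of "{1..s}" a 0] pos discrete_valuation_nonneg[OF val assms(3)] by simp
  then consider "?\<mu> = \<infinity>" | r where "?\<mu> = ereal r" "0 \<le> r" by (cases ?\<mu>) auto
  then have "(\<lambda>n. ereal_of_enat (filtration_order I (x [^]\<^bsub>R\<^esub> Suc n)) / ereal (real (Suc n)))
      \<longlonglongrightarrow> ?\<mu>"
  proof cases
    case 1
    \<comment> \<open>An infinite minimum puts every positive power of \<open>x\<close> into all the
      ideals \<open>I m\<close>.\<close>
    then have "filtration_order I (x [^]\<^bsub>R\<^esub> Suc n) = \<infinity>" for n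
      unfolding filtration_order_def valued_family_power_iff[OF assms] by (simp add: full_SetCompr_eq Sup_range_enat)
    then show ?thesis unfolding 1 by simp
  next
    case (2 r)
    have "filtration_order I (x [^]\<^bsub>R\<^esub> Suc n) = enat (nat \<lfloor>real (Suc n) * r\<rfloor>)" for n
    proof -
      have "real m / real (Suc n) \<le> r \<longleftrightarrow> real m \<le> real (Suc n) * r" for m
        by (simp add: divide_le_eq mult.commute)
      then show ?thesis
        unfolding filtration_order_def valued_family_power_iff[OF assms] 2(1)
        using enat_Sup_real_le[of "real (Suc n) * r"] 2(2) by simp
    qed
    then show ?thesis
      unfolding 2(1) using floor_mult_over_tendsto[OF 2(2)] by (simp del: of_nat_Suc)
  qed
  \<comment> \<open>Undoing the shift does not change the limit, so the junk term at
    \<open>n = 0\<close> is harmless.\<close>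
  then have "(\<lambda>n. ereal_of_enat (filtration_order I (x [^]\<^bsub>R\<^esub> n)) / ereal (real n)) \<longlonglongrightarrow> ?\<mu>"
    by (rule LIMSEQ_imp_Suc)
  then show ?thesis unfolding asymptotic_samuel_def by (rule limI)
qed

text \<open>This is the power criterion for exponent 1. It recovers the filtration from its
  asymptotic Samuel function, which yields the forward direction of the theorem.\<close>

lemma mem_iff_le_asymptotic_samuel:
  assumes "cring R" "dv_representation R s v a I"
  shows "x \<in> I m \<longleftrightarrow> x \<in> carrier R \<and> ereal (real m) \<le> asymptotic_samuel R I x"
proof -
  interpret cring R by fact
  \<comment> \<open>The index set is nonempty because \<open>1 \<le> s\<close>, so the intersection
    stays inside the carrier.\<close>
  have "I m \<subseteq> carrier R"
    using assms(2) by (force simp: dv_representation_def valued_family_def valuation_ideal_def)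
  then show ?thesis
    using valued_family_power_iff[OF assms, of x 0 m] asymptotic_samuel_eq_INF[OF assms, of x]
    by auto
qed

text \<open>Provides the representation needed to apply the formula for the asymptotic Samuel
  function to the scaled filtration.\<close>

lemma dv_representation_scaled:
  assumes "cring R" "dv_representation R s v a I" "0 < \<alpha>"
  shows "dv_representation R s v (\<lambda>i. \<alpha> * a i) (scaled_filtration R I \<alpha>)"
  using assms(2,3) scaled_filtration_eq[OF assms] by (simp add: dv_representation_def)

lemma asymptotic_samuel_scaled_filtration:
  assumes "cring R" "dv_representation R s v a I" "0 < \<alpha>" "x \<in> carrier R"
  shows "asymptotic_samuel R I x = ereal \<alpha> * asymptotic_samuel R (scaled_filtration R I \<alpha>) x"
proof -
  have pos: "0 < a i" if "i \<in> {1..s}" for i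
    using assms(2) that by (auto simp: dv_representation_def)
  have "y \<le> asymptotic_samuel R I x \<longleftrightarrow>
      y / ereal \<alpha> \<le> asymptotic_samuel R (scaled_filtration R I \<alpha>) x" for y
  proof -
    \<comment> \<open>The factor \<open>\<alpha>\<close> cancels even for infinite \<open>y\<close>,
      since it is positive and finite.\<close>
    have "ereal (\<alpha> * a i) * (y / ereal \<alpha>) = ereal (a i) * y" if "i \<in> {1..s}" for i
      using assms(3) pos[OF that] by (cases y) auto
    then show ?thesis
      using le_INF_divide_iff[of "{1..s}" a y] le_INF_divide_iff[of "{1..s}" "\<lambda>i. \<alpha> * a i" "y / ereal \<alpha>"]
        pos assms(3)
      unfolding asymptotic_samuel_eq_INF[OF assms(1,2,4)]
        asymptotic_samuel_eq_INF[OF assms(1) dv_representation_scaled[OF assms(1-3)] assms(4)]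
      by simp
  qed
  then have "y \<le> asymptotic_samuel R I x \<longleftrightarrow>
      y \<le> ereal \<alpha> * asymptotic_samuel R (scaled_filtration R I \<alpha>) x" for y
    using assms(3) by (simp add: ereal_divide_le_pos)
  \<comment> \<open>Two elements with the same lower bounds are equal: take each of them as
    \<open>y\<close>.\<close>
  then show ?thesis by (meson order.antisym order.refl)
qed

theorem theorem1p8:
  fixes R :: "('a, 'b) ring_scheme"
    and I J :: "nat \<Rightarrow> 'a set"
    and \<alpha> :: real
  assumes "cring R"
    and "noetherian_ring R"
    and "discrete_valued_filtration R I"
    and "discrete_valued_filtration R J"
    and "0 < \<alpha>"
  shows "(\<forall>x \<in> carrier R. asymptotic_samuel R I x = ereal \<alpha> * asymptotic_samuel R J x)
           \<longleftrightarrow> J = scaled_filtration R I \<alpha>"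
proof -
  obtain s v a where I: "dv_representation R s v a I"
    using assms(3) by (auto simp: discrete_valued_filtration_def)
  obtain s' v' b where J: "dv_representation R s' v' b J"
    using assms(4) by (auto simp: discrete_valued_filtration_def)
  note scaled = asymptotic_samuel_scaled_filtration[OF assms(1) I assms(5)]
  note repK = dv_representation_scaled[OF assms(1) I assms(5)]
  show ?thesis
  proof
    assume eq: "\<forall>x \<in> carrier R. asymptotic_samuel R I x = ereal \<alpha> * asymptotic_samuel R J x"
    have "asymptotic_samuel R J x = asymptotic_samuel R (scaled_filtration R I \<alpha>) x"
      if "x \<in> carrier R" for x
    proof -
      have "ereal \<alpha> * asymptotic_samuel R J x
          = ereal \<alpha> * asymptotic_samuel R (scaled_filtration R I \<alpha>) x"
        using eq scaled that by simp
      \<comment> \<open>Cancelling \<open>\<alpha>\<close> is sound at infinite values too, as it is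
        finite and nonzero.\<close>
      then show ?thesis using assms(5) by (simp add: ereal_mult_cancel_left)
    qed
    then show "J = scaled_filtration R I \<alpha>"
      by (intro HOL.ext Set.set_eqI)
        (auto simp: mem_iff_le_asymptotic_samuel[OF assms(1) J]
          mem_iff_le_asymptotic_samuel[OF assms(1) repK])
  qed (use scaled in simp)
qed

end
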